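(* Let $X \subseteq \mathbb{P}^N$ be an irreducible nondegenerate algebraic variety. Fix an integer $r \geq 2$ and let $L$ be a line in $\mathbb{P}^N$ with the following properties: (1) there exists $z \in L \cap X$; (2) there exist distinct elements $q_0, q_1 \in L \cap \sigma_r(X)$ with $q_0, q_1$ distinct from $z$; (3) $L \not\subseteq \sigma_r(X)$. Then there exists $p \in \mathbb{P}^N$ such that $\underline{\mathrm{R}}_X(p) = r+1$ and, for every $k \geq 2$, $$\underline{\mathrm{R}}_{X^{\times k}}(p^{\otimes k}) \leq \frac{1}{2}\Big( (r+1)^k + 2 r^k - (r-1)^k \Big) < (r+1)^k .$$ In particular, $p$ verifies strict submultiplicativity of border rank, i.e. $\underline{\mathrm{R}}_{X^{\times k}}(p^{\otimes k}) < \underline{\mathrm{R}}_X(p)^k$ for every $k\ge 2$.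
   Context: We work over $\mathbb{C}$; varieties are projective algebraic varieties, and nondegenerate means not contained in a hyperplane. For a variety $X \subseteq \mathbb{P}^N$ and $p \in \mathbb{P}^N$, the $X$-rank $\mathrm{R}_X(p)$ is the minimum $r$ such that $p$ lies in the projective linear span of some $z_1,\dots,z_r \in X$. The $r$-th secant variety $\sigma_r(X)$ is the Zariski closure of $\{p \in \mathbb{P}^N : \mathrm{R}_X(p) \leq r\}$, and the $X$-border rank is $\underline{\mathrm{R}}_X(p) = \min\{r : p \in \sigma_r(X)\}$. $X^{\times k}$ denotes $X \times \cdots \times X$ ($k$ copies), regarded as a subvariety of $\mathbb{P}((\mathbb{C}^{N+1})^{\otimes k}) = \mathbb{P}^{(N+1)^k-1}$ via the Segre embedding $([v_1],\dots,[v_k]) \mapsto [v_1 \otimes \cdots \otimes v_k]$. For $p = [v] \in \mathbb{P}^N$, $p^{\otimes k} = [v^{\otimes k}] \in \mathbb{P}^{(N+1)^k - 1}$. *)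

theory Defs
  imports
    Complex_Main
    "HOL-Library.FuncSet"
    "HOL-Library.Function_Algebras"
    "HOL-Library.Poly_Mapping"
    "HOL-Library.Extended_Nat"
    "HOL-Library.Extended_Real"
begin

section \<open>Projective spaces over the complex numbers\<close>

text \<open>
  The dimensions of the tensor powers vary with an exponent that is quantified inside the
  statement, so coordinate spaces are not indexed by types. The vector space with coordinates
  indexed by a finite set \<open>I\<close> consists of the functions \<open>'i \<Rightarrow> complex\<close> that vanish outside \<open>I\<close>.
  Thus \<open>{..N}\<close> gives the coordinate space of dimension \<open>N + 1\<close>, and the lists of length \<open>k\<close> over
  \<open>I\<close> index its \<open>k\<close>-th tensor power.
\<close>

definition vecs :: "'i set \<Rightarrow> ('i \<Rightarrow> complex) set" where
  "vecs I = {v. \<forall>i. i \<notin> I \<longrightarrow> v i = 0}"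

definition cscale :: "complex \<Rightarrow> ('i \<Rightarrow> complex) \<Rightarrow> ('i \<Rightarrow> complex)" where
  "cscale c v = (\<lambda>i. c * v i)"

global_interpretation cvec: vector_space cscale
  defines cspan = cvec.span
  by standard (auto simp: cscale_def fun_eq_iff algebra_simps)

text \<open>A point of projective space is the set of its homogeneous coordinate vectors.\<close>

type_synonym 'i point = "('i \<Rightarrow> complex) set"

definition proj_pt :: "('i \<Rightarrow> complex) \<Rightarrow> 'i point" where
  "proj_pt v = {cscale c v | c. c \<noteq> 0}"

definition proj_space :: "'i set \<Rightarrow> 'i point set" where
  "proj_space I = proj_pt ` (vecs I - {0})"

definition proj_span :: "'i point set \<Rightarrow> 'i point set" where
  "proj_span Z = proj_pt ` (cspan (\<Union>Z) - {0})"

definition is_line :: "'i set \<Rightarrow> 'i point set \<Rightarrow> bool" where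
  "is_line I L \<longleftrightarrow> (\<exists>a\<in>proj_space I. \<exists>b\<in>proj_space I. a \<noteq> b \<and> L = proj_span {a, b})"

section \<open>Projective varieties\<close>

text \<open>Polynomials map exponent vectors to coefficients.\<close>

type_synonym 'i mpoly = "('i \<Rightarrow>\<^sub>0 nat) \<Rightarrow>\<^sub>0 complex"

definition mpoly_eval :: "'i mpoly \<Rightarrow> ('i \<Rightarrow> complex) \<Rightarrow> complex" where
  "mpoly_eval f v =
     (\<Sum>m\<in>Poly_Mapping.keys f.
        Poly_Mapping.lookup f m * (\<Prod>i\<in>Poly_Mapping.keys m. v i ^ Poly_Mapping.lookup m i))"

definition homogeneous :: "'i set \<Rightarrow> nat \<Rightarrow> 'i mpoly \<Rightarrow> bool" where
  "homogeneous I d f \<longleftrightarrow>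
     (\<forall>m\<in>Poly_Mapping.keys f. Poly_Mapping.keys m \<subseteq> I \<and>
        (\<Sum>i\<in>Poly_Mapping.keys m. Poly_Mapping.lookup m i) = d)"

definition zero_locus :: "'i set \<Rightarrow> 'i mpoly set \<Rightarrow> 'i point set" where
  "zero_locus I S = {p \<in> proj_space I. \<forall>f\<in>S. \<forall>v\<in>p. mpoly_eval f v = 0}"

definition proj_variety :: "'i set \<Rightarrow> 'i point set \<Rightarrow> bool" where
  "proj_variety I X \<longleftrightarrow> (\<exists>S. (\<forall>f\<in>S. \<exists>d. homogeneous I d f) \<and> X = zero_locus I S)"

definition irreducible_variety :: "'i set \<Rightarrow> 'i point set \<Rightarrow> bool" where
  "irreducible_variety I X \<longleftrightarrow> proj_variety I X \<and> X \<noteq> {} \<and>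
     (\<forall>A B. proj_variety I A \<and> proj_variety I B \<and> X = A \<union> B \<longrightarrow> X = A \<or> X = B)"

definition hyperplane :: "'i set \<Rightarrow> 'i point set \<Rightarrow> bool" where
  "hyperplane I H \<longleftrightarrow> (\<exists>f. f \<noteq> 0 \<and> homogeneous I 1 f \<and> H = zero_locus I {f})"

definition nondegenerate :: "'i set \<Rightarrow> 'i point set \<Rightarrow> bool" where
  "nondegenerate I X \<longleftrightarrow> \<not> (\<exists>H. hyperplane I H \<and> X \<subseteq> H)"

definition zariski_closure :: "'i set \<Rightarrow> 'i point set \<Rightarrow> 'i point set" where
  "zariski_closure I A = \<Inter>{Z. proj_variety I Z \<and> A \<subseteq> Z}"

section \<open>Rank, secant varieties and border rank\<close>

text \<open>
  The two minima below are infima in \<^typ>\<open>enat\<close>; an infimum over a nonempty set is attained,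
  and it is \<open>\<infinity>\<close> if no admissible number exists.
\<close>

definition X_rank :: "'i point set \<Rightarrow> 'i point \<Rightarrow> enat" where
  "X_rank X p =
     (INF r\<in>{r. \<exists>z. (\<forall>j\<in>{1..r}. z j \<in> X) \<and> p \<in> proj_span (z ` {1..r})}. enat r)"

definition secant_variety :: "'i set \<Rightarrow> nat \<Rightarrow> 'i point set \<Rightarrow> 'i point set" where
  "secant_variety I r X = zariski_closure I {p \<in> proj_space I. X_rank X p \<le> enat r}"

definition border_rank :: "'i set \<Rightarrow> 'i point set \<Rightarrow> 'i point \<Rightarrow> enat" where
  "border_rank I X p = (INF r\<in>{r. p \<in> secant_variety I r X}. enat r)"

section \<open>Tensor powers and the Segre embedding\<close>

definition tensor_idx :: "'i set \<Rightarrow> nat \<Rightarrow> 'i list set" where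
  "tensor_idx I k = {is. set is \<subseteq> I \<and> length is = k}"

text \<open>The coordinates of \<open>v 0 \<otimes> \<dots> \<otimes> v (k - 1)\<close>.\<close>

definition tensor :: "nat \<Rightarrow> (nat \<Rightarrow> 'i \<Rightarrow> complex) \<Rightarrow> ('i list \<Rightarrow> complex)" where
  "tensor k v = (\<lambda>is. if length is = k then (\<Prod>j<k. v j (is ! j)) else 0)"

text \<open>
  The unions over representatives are unions of identical sets: the class of the tensor
  does not depend on the representatives.
\<close>

definition segre :: "nat \<Rightarrow> (nat \<Rightarrow> 'i point) \<Rightarrow> 'i list point" where
  "segre k P = (\<Union>v\<in>PiE {..<k} P. proj_pt (tensor k v))"

definition segre_power :: "nat \<Rightarrow> 'i point set \<Rightarrow> 'i list point set" where
  "segre_power k X = segre k ` PiE {..<k} (\<lambda>_. X)"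

definition tensor_power_pt :: "nat \<Rightarrow> 'i point \<Rightarrow> 'i list point" where
  "tensor_power_pt k p = (\<Union>v\<in>p. proj_pt (tensor k (\<lambda>_. v)))"

end

theory Submission
  imports Defs "HOL-Computational_Algebra.Polynomial"
begin

text \<open>
  The line \<open>L\<close> meets \<open>\<sigma>\<^sub>r(X)\<close> in finitely many points. Choose vectors \<open>\<kappa>\<close> over \<open>q0\<close> and \<open>w\<close> over
  \<open>z\<close> such that \<open>\<kappa> + w\<close> lies over \<open>q1\<close>. The progression \<open>\<kappa>, \<kappa> + w, \<kappa> + 2w, \<dots>\<close> starts with two
  members in (the affine cone over) \<open>\<sigma>\<^sub>r(X)\<close> and cannot stay there
  for ever, because a polynomial that vanishes on \<open>\<sigma>\<^sub>r(X)\<close> but not on all of \<open>L\<close> has finitely many zeros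
  on it. So some three successive members are \<open>m - w\<close>, \<open>m\<close>, \<open>m + w\<close>, the first two in \<open>\<sigma>\<^sub>r(X)\<close>
  and the third outside (\<open>exit_from_progression\<close>). The required point is \<open>p = [m + w]\<close>: it is
  outside \<open>\<sigma>\<^sub>r(X)\<close>, and it is in \<open>\<sigma>\<^sub>r\<^sub>+\<^sub>1(X)\<close> as the sum of \<open>m\<close> and a vector over a point of \<open>X\<close>.

  Expand \<open>(m + w)\<^sup>\<otimes>\<^sup>k\<close> and \<open>(m - w)\<^sup>\<otimes>\<^sup>k\<close> over the sets \<open>S\<close> of slots that carry \<open>w\<close>. The terms with
  \<open>|S|\<close> even agree and those with \<open>|S|\<close> odd are opposite, so
  \<open>(m + w)\<^sup>\<otimes>\<^sup>k = (m - w)\<^sup>\<otimes>\<^sup>k + 2 \<Sum> w\<^sup>S m\<^sup>S\<^sup>'\<close>, where \<open>S\<close> runs over the sets of odd size and \<open>S'\<close> is the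
  complement of \<open>S\<close> (\<open>tensor_power_odd_part\<close>). Border rank is subadditive and submultiplicative, so
  the border rank of the left side is at most \<open>r\<^sup>k\<close> plus the sum of \<open>r\<close> to the power \<open>k - |S|\<close> over
  the odd \<open>S\<close>. The same identity, applied to the numbers \<open>r\<close> and \<open>1\<close> instead of \<open>m\<close> and \<open>w\<close>,
  evaluates this count as half of \<open>(r + 1)\<^sup>k + 2 r\<^sup>k - (r - 1)\<^sup>k\<close> (\<open>odd_count_eq\<close>).

  Both properties of border rank come from one fact: a polynomial map that sends a set \<open>A\<close> into a
  closed set also sends the Zariski closure of \<open>A\<close> there (\<open>affine_closure_polymap\<close>), to be used in
  one summand or one tensor factor at a time. The maps in question, such as a translation, are not
  homogeneous. Therefore secant varieties are replaced by their affine cones, closed with respect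
  to all polynomials. This makes no difference, since the ideal of a cone is homogeneous
  (\<open>affine_closure_cone\<close>).
\<close>

section \<open>Polynomial functions\<close>

lemma mpoly_eval_superset:
  assumes "finite A" "Poly_Mapping.keys f \<subseteq> A"
  shows "mpoly_eval f v =
    (\<Sum>m\<in>A. Poly_Mapping.lookup f m * (\<Prod>i\<in>Poly_Mapping.keys m. v i ^ Poly_Mapping.lookup m i))"
  unfolding mpoly_eval_def
  by (rule sum.mono_neutral_left) (use assms in \<open>auto simp: in_keys_iff\<close>)

lemma mpoly_eval_add: "mpoly_eval (f + g) v = mpoly_eval f v + mpoly_eval g v"
proof -
  let ?A = "Poly_Mapping.keys f \<union> Poly_Mapping.keys g"
  have "Poly_Mapping.keys (f + g) \<subseteq> ?A" by (rule Poly_Mapping.keys_add)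
  then show ?thesis
    by (simp add: mpoly_eval_superset[of ?A] lookup_add distrib_right sum.distrib)
qed

definition monom_val :: "('i \<Rightarrow>\<^sub>0 nat) \<Rightarrow> ('i \<Rightarrow> complex) \<Rightarrow> complex" where
  "monom_val m v = (\<Prod>i\<in>Poly_Mapping.keys m. v i ^ Poly_Mapping.lookup m i)"

lemma mpoly_eval_single: "mpoly_eval (Poly_Mapping.single m c) v = c * monom_val m v"
  by (simp add: mpoly_eval_superset[of "{m}"] monom_val_def)

lemma mpoly_eval_zero: "mpoly_eval 0 v = 0"
  by (simp add: mpoly_eval_def)

lemma monom_val_superset:
  assumes "finite A" "Poly_Mapping.keys m \<subseteq> A"
  shows "monom_val m v = (\<Prod>i\<in>A. v i ^ Poly_Mapping.lookup m i)"
  unfolding monom_val_def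
  by (rule prod.mono_neutral_left) (use assms in \<open>auto simp: in_keys_iff\<close>)

lemma monom_val_add: "monom_val (m + n) v = monom_val m v * monom_val n v"
proof -
  let ?A = "Poly_Mapping.keys m \<union> Poly_Mapping.keys n"
  have "Poly_Mapping.keys (m + n) \<subseteq> ?A" by (rule Poly_Mapping.keys_add)
  then show ?thesis
    by (simp add: monom_val_superset[of ?A] lookup_add power_add prod.distrib)
qed

text \<open>
  Polynomial functions are generated additively from monomials, so that their homogeneous
  components can be read off by induction.
\<close>

inductive polyfun :: "'i set \<Rightarrow> (('i \<Rightarrow> complex) \<Rightarrow> complex) \<Rightarrow> bool" for I where
  polyfun_monom: "Poly_Mapping.keys m \<subseteq> I \<Longrightarrow> polyfun I (\<lambda>v. c * monom_val m v)"
| polyfun_add: "polyfun I f \<Longrightarrow> polyfun I g \<Longrightarrow> polyfun I (\<lambda>v. f v + g v)"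

lemma polyfun_const: "polyfun I (\<lambda>_. c)"
  using polyfun_monom[of 0 I c] by (simp add: monom_val_def)

lemma polyfun_var: "i \<in> I \<Longrightarrow> polyfun I (\<lambda>v. v i)"
  using polyfun_monom[of "Poly_Mapping.single i 1" I 1] by (simp add: monom_val_def)

text \<open>
  The definition provides only sums, so the product of two monomials has to be recognised as a
  monomial. Closure under products is what makes the composition of polynomial maps available.
\<close>

lemma polyfun_mult:
  assumes "polyfun I f" "polyfun I g"
  shows "polyfun I (\<lambda>v. f v * g v)"
  using assms(1)
proof induction
  case (polyfun_monom m c)
  from assms(2) show ?case
  proof induction
    case (polyfun_monom n d)
    have "Poly_Mapping.keys (m + n) \<subseteq> I"
      using Poly_Mapping.keys_add[of m n] \<open>Poly_Mapping.keys m \<subseteq> I\<close> polyfun_monom by blast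
    from polyfun.polyfun_monom[OF this, of "c * d"] show ?case
      by (simp add: monom_val_add mult_ac)
  next
    case (polyfun_add f g)
    then show ?case by (simp add: distrib_left polyfun.polyfun_add)
  qed
next
  case (polyfun_add f g)
  then show ?case by (simp add: distrib_right polyfun.polyfun_add)
qed

lemma polyfun_power: "polyfun I f \<Longrightarrow> polyfun I (\<lambda>v. f v ^ n)"
  by (induction n) (auto intro: polyfun_const polyfun_mult)

lemma polyfun_prod: "(\<And>j. j \<in> A \<Longrightarrow> polyfun I (f j)) \<Longrightarrow> polyfun I (\<lambda>v. \<Prod>j\<in>A. f j v)"
  by (induction A rule: infinite_finite_induct) (auto intro: polyfun_const polyfun_mult)

lemma polyfun_compose:
  assumes "polyfun J f" "\<And>j. j \<in> J \<Longrightarrow> polyfun I (\<lambda>v. \<phi> v j)"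
  shows "polyfun I (\<lambda>v. f (\<phi> v))"
  using assms(1)
proof induction
  case (polyfun_monom m c)
  then show ?case unfolding monom_val_def
    by (intro polyfun_mult polyfun_const polyfun_prod polyfun_power assms(2)) auto
next
  case (polyfun_add f g)
  show ?case by (rule polyfun.polyfun_add; fact)
qed

text \<open>
  A polynomial function has finitely many zeros on a line on which it does not vanish identically;
  passing to the univariate polynomial gives access to this fact.
\<close>

lemma polyfun_on_line:
  assumes "polyfun I f"
  shows "\<exists>P. \<forall>t. f (u + cscale t w) = poly P t"
  using assms
proof induction
  case (polyfun_monom m c)
  have "c * monom_val m (u + cscale t w) =
      poly ([:c:] * (\<Prod>i\<in>Poly_Mapping.keys m. [:u i, w i:] ^ Poly_Mapping.lookup m i)) t" for t
    by (simp add: monom_val_def poly_prod cscale_def)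
  then show ?case by blast
next
  case (polyfun_add f g)
  then obtain P Q where "\<forall>t. f (u + cscale t w) = poly P t" "\<forall>t. g (u + cscale t w) = poly Q t"
    by blast
  then have "\<forall>t. f (u + cscale t w) + g (u + cscale t w) = poly (P + Q) t" by simp
  then show ?case by blast
qed

lemma polyfun_mpoly_eval:
  assumes "homogeneous I d F"
  shows "polyfun I (mpoly_eval F)"
proof -
  have *: "polyfun I (\<lambda>v. \<Sum>m\<in>M. Poly_Mapping.lookup F m * monom_val m v)"
    if "finite M" "M \<subseteq> Poly_Mapping.keys F" for M
    using that
    by (induction M)
      (use assms in \<open>auto intro!: polyfun_const polyfun_add polyfun_monom simp: homogeneous_def\<close>)
  from *[of "Poly_Mapping.keys F"] show ?thesis
    by (simp add: mpoly_eval_def[abs_def] monom_val_def)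
qed

lemma mpoly_eval_cscale:
  assumes "homogeneous I d F"
  shows "mpoly_eval F (cscale t v) = t ^ d * mpoly_eval F v"
proof -
  have "(\<Prod>i\<in>Poly_Mapping.keys m. cscale t v i ^ Poly_Mapping.lookup m i) =
      t ^ d * (\<Prod>i\<in>Poly_Mapping.keys m. v i ^ Poly_Mapping.lookup m i)"
    if "m \<in> Poly_Mapping.keys F" for m
    using assms that
    by (auto simp: homogeneous_def cscale_def power_mult_distrib prod.distrib power_sum[symmetric])
  then show ?thesis
    by (auto simp: mpoly_eval_def sum_distrib_left intro!: sum.cong)
qed

lemma homogeneous_add:
  "homogeneous I d F \<Longrightarrow> homogeneous I d G \<Longrightarrow> homogeneous I d (F + G)"
  using Poly_Mapping.keys_add[of F G] by (auto simp: homogeneous_def)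

lemma polyfun_homogeneous_components:
  assumes "polyfun I f"
  shows "\<exists>F D. (\<forall>d. homogeneous I d (F d)) \<and> (\<forall>n\<ge>D. \<forall>v. f v = (\<Sum>d\<le>n. mpoly_eval (F d) v))"
  using assms
proof induction
  case (polyfun_monom m c)
  define e where "e = (\<Sum>i\<in>Poly_Mapping.keys m. Poly_Mapping.lookup m i)"
  define F where "F d = (if d = e then Poly_Mapping.single m c else 0)" for d
  have "homogeneous I d (F d)" for d
    using polyfun_monom by (auto simp: homogeneous_def F_def e_def)
  moreover have "c * monom_val m v = (\<Sum>d\<le>n. mpoly_eval (F d) v)" if "n \<ge> e" for n v
  proof -
    have "(\<Sum>d\<le>n. mpoly_eval (F d) v) = (\<Sum>d\<le>n. if d = e then c * monom_val m v else 0)"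
      by (rule sum.cong) (auto simp: F_def mpoly_eval_single mpoly_eval_zero)
    with that show ?thesis by simp
  qed
  ultimately show ?case by blast
next
  case (polyfun_add f g)
  then obtain F D G E where FG:
    "\<forall>d. homogeneous I d (F d)" "\<forall>n\<ge>D. \<forall>v. f v = (\<Sum>d\<le>n. mpoly_eval (F d) v)"
    "\<forall>d. homogeneous I d (G d)" "\<forall>n\<ge>E. \<forall>v. g v = (\<Sum>d\<le>n. mpoly_eval (G d) v)"
    by blast
  have "\<forall>d. homogeneous I d (F d + G d)"
    using FG by (simp add: homogeneous_add)
  moreover have "\<forall>n\<ge>max D E. \<forall>v. f v + g v = (\<Sum>d\<le>n. mpoly_eval (F d + G d) v)"
    by (auto simp: mpoly_eval_add sum.distrib FG(2)[rule_format, symmetric]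
        FG(4)[rule_format, symmetric])
  ultimately show ?case by (intro exI[of _ "\<lambda>d. F d + G d"] exI[of _ "max D E"] conjI)
qed

section \<open>Zariski closures of cones\<close>

definition affine_closure :: "'i set \<Rightarrow> ('i \<Rightarrow> complex) set \<Rightarrow> ('i \<Rightarrow> complex) set" where
  "affine_closure I A = {v \<in> vecs I. \<forall>f. polyfun I f \<and> (\<forall>a\<in>A. f a = 0) \<longrightarrow> f v = 0}"

lemma affine_closure_superset: "A \<subseteq> vecs I \<Longrightarrow> A \<subseteq> affine_closure I A"
  by (auto simp: affine_closure_def)

text \<open>
  Polynomial maps are continuous in the Zariski topology: the pullback under \<open>\<phi>\<close> of an equation of
  \<open>B\<close> vanishes on \<open>A\<close>, hence at \<open>v\<close>. Membership of \<open>\<phi> a\<close> is required only in the closure of \<open>B\<close>,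
  so that several arguments of a map can be moved into closures one after another.
\<close>

lemma affine_closure_polymap:
  assumes v: "v \<in> affine_closure I A"
    and \<phi>: "\<And>j. j \<in> J \<Longrightarrow> polyfun I (\<lambda>v. \<phi> v j)" "\<phi> v \<in> vecs J"
    and A: "\<And>a. a \<in> A \<Longrightarrow> \<phi> a \<in> affine_closure J B"
  shows "\<phi> v \<in> affine_closure J B"
proof -
  have "f (\<phi> v) = 0" if f: "polyfun J f" "\<forall>b\<in>B. f b = 0" for f
  proof -
    have "polyfun I (\<lambda>v. f (\<phi> v))" by (rule polyfun_compose[OF f(1) \<phi>(1)])
    moreover have "\<forall>a\<in>A. f (\<phi> a) = 0" using A f by (auto simp: affine_closure_def)
    ultimately show ?thesis using v by (auto simp: affine_closure_def)
  qed
  with \<phi>(2) show ?thesis by (auto simp: affine_closure_def)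
qed

text \<open>
  The restriction of a polynomial to the line through \<open>a \<in> A\<close> and the origin is a polynomial in the
  scalar, whose coefficients are the values at \<open>a\<close> of the homogeneous components. If it vanishes
  identically, so does every component. Hence the homogeneous equations of a cone already cut out
  its closure.
\<close>

lemma affine_closure_cone:
  assumes cone: "\<And>t a. a \<in> A \<Longrightarrow> cscale t a \<in> A"
    and v: "v \<in> vecs I"
    and hom: "\<And>d F. homogeneous I d F \<Longrightarrow> \<forall>a\<in>A. mpoly_eval F a = 0 \<Longrightarrow> mpoly_eval F v = 0"
  shows "v \<in> affine_closure I A"
proof -
  have "f v = 0" if f: "polyfun I f" "\<forall>a\<in>A. f a = 0" for f
  proof -
    obtain F D where F: "\<And>d. homogeneous I d (F d)"
      and D: "\<And>n v. n \<ge> D \<Longrightarrow> f v = (\<Sum>d\<le>n. mpoly_eval (F d) v)"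
      using polyfun_homogeneous_components[OF f(1)] by blast
    have "mpoly_eval (F d) a = 0" if "a \<in> A" "d \<le> D" for d a
    proof -
      have "(\<Sum>d\<le>D. mpoly_eval (F d) a * t ^ d) = 0" for t
      proof -
        have "f (cscale t a) = 0" using cone f(2) that by blast
        then show ?thesis using F by (simp add: D[of D] mpoly_eval_cscale[OF F] mult.commute)
      qed
      then show ?thesis using polyfun_eq_0[of "\<lambda>d. mpoly_eval (F d) a" D] that by blast
    qed
    then have "mpoly_eval (F d) v = 0" if "d \<le> D" for d using that hom F by blast
    then show ?thesis by (simp add: D[of D])
  qed
  with v show ?thesis by (auto simp: affine_closure_def)
qed

lemma vecs_add: "v \<in> vecs I \<Longrightarrow> w \<in> vecs I \<Longrightarrow> v + w \<in> vecs I"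
  by (auto simp: vecs_def)

lemma vecs_cscale: "v \<in> vecs I \<Longrightarrow> cscale c v \<in> vecs I"
  by (auto simp: vecs_def cscale_def)

text \<open>
  Addition is jointly polynomial, but closures are taken in each summand separately: first \<open>v\<close>
  moves into the closure of \<open>A\<close> against a fixed \<open>b \<in> B\<close>, then \<open>b\<close> moves against that \<open>v\<close>.
\<close>

lemma affine_closure_add:
  assumes "v \<in> affine_closure I A" "w \<in> affine_closure I B"
    and AB: "\<And>a b. a \<in> A \<Longrightarrow> b \<in> B \<Longrightarrow> a + b \<in> affine_closure I C"
    and "A \<subseteq> vecs I" "B \<subseteq> vecs I"
  shows "v + w \<in> affine_closure I C"
proof -
  have vw: "v \<in> vecs I" "w \<in> vecs I" using assms by (auto simp: affine_closure_def)
  have "v + b \<in> affine_closure I C" if "b \<in> B" for b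
    by (rule affine_closure_polymap[OF assms(1), of I "\<lambda>x. x + b"])
      (use that assms vw in \<open>auto intro!: polyfun_add polyfun_var polyfun_const vecs_add\<close>)
  then show ?thesis
    by (intro affine_closure_polymap[OF assms(2), of I "\<lambda>x. v + x"])
      (use vw in \<open>auto intro!: polyfun_add polyfun_var polyfun_const vecs_add\<close>)
qed

lemma affine_closure_cscale:
  assumes cone: "\<And>t a. a \<in> A \<Longrightarrow> cscale t a \<in> A" and "A \<subseteq> vecs I"
    and v: "v \<in> affine_closure I A"
  shows "cscale c v \<in> affine_closure I A"
proof (rule affine_closure_polymap[OF v, of I "cscale c"])
  show "polyfun I (\<lambda>v. cscale c v j)" if "j \<in> I" for j
    unfolding cscale_def using that by (intro polyfun_mult polyfun_const polyfun_var)
  show "cscale c v \<in> vecs I" using v by (auto simp: affine_closure_def intro: vecs_cscale)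
  show "cscale c a \<in> affine_closure I A" if "a \<in> A" for a
    using that cone affine_closure_superset[OF assms(2)] by blast
qed

lemma tensor_in_vecs:
  assumes "\<And>j. j < k \<Longrightarrow> v j \<in> vecs I"
  shows "tensor k v \<in> vecs (tensor_idx I k)"
proof -
  have "tensor k v is = 0" if "is \<notin> tensor_idx I k" for "is"
  proof (cases "length is = k")
    case True
    with that obtain x where "x \<in> set is" "x \<notin> I" by (auto simp: tensor_idx_def)
    then obtain j where "j < k" "is ! j \<notin> I" using True by (auto simp: in_set_conv_nth)
    then show ?thesis using assms[of j] True
      by (auto simp: tensor_def vecs_def intro!: bexI[of _ j])
  qed (simp add: tensor_def)
  then show ?thesis by (auto simp: vecs_def)
qed

lemma polyfun_tensor_slot:
  assumes "is \<in> tensor_idx I k"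
  shows "polyfun I (\<lambda>x. tensor k (v(n := x)) is)"
proof -
  have "polyfun I (\<lambda>x. (v(n := x)) j (is ! j))" if "j < k" for j
  proof (cases "j = n")
    case True
    have "is ! j \<in> I" using assms that by (auto simp: tensor_idx_def)
    with True show ?thesis by (auto intro: polyfun_var)
  qed (auto intro: polyfun_const)
  then show ?thesis using assms by (auto simp: tensor_def tensor_idx_def intro!: polyfun_prod)
qed

text \<open>
  The tensor product is polynomial in each factor, so the factors can be moved from \<open>A j\<close> to its
  closure one at a time; the induction is on the number of factors already moved.
\<close>

lemma affine_closure_tensor:
  assumes v: "\<And>j. j < k \<Longrightarrow> v j \<in> affine_closure I (A j)"
    and A: "\<And>j. j < k \<Longrightarrow> A j \<subseteq> vecs I"
    and B: "\<And>a. (\<And>j. j < k \<Longrightarrow> a j \<in> A j) \<Longrightarrow> tensor k a \<in> affine_closure (tensor_idx I k) B"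
  shows "tensor k v \<in> affine_closure (tensor_idx I k) B"
proof -
  have "tensor k w \<in> affine_closure (tensor_idx I k) B"
    if "n \<le> k" "\<And>j. j < n \<Longrightarrow> w j \<in> affine_closure I (A j)" "\<And>j. n \<le> j \<Longrightarrow> j < k \<Longrightarrow> w j \<in> A j"
    for n w
    using that
  proof (induction n arbitrary: w)
    case 0
    then show ?case using B by simp
  next
    case (Suc n)
    have "tensor k (w(n := w n)) \<in> affine_closure (tensor_idx I k) B"
    proof (rule affine_closure_polymap[where \<phi> = "\<lambda>x. tensor k (w(n := x))"])
      show "w n \<in> affine_closure I (A n)" using Suc.prems by simp
      show "polyfun I (\<lambda>x. tensor k (w(n := x)) is)" if "is \<in> tensor_idx I k" for "is"
        by (rule polyfun_tensor_slot[OF that])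
      have "w j \<in> vecs I" if "j < k" for j
      proof (cases "j < Suc n")
        case True
        then show ?thesis using Suc.prems(2)[of j] by (auto simp: affine_closure_def)
      next
        case False
        then show ?thesis using Suc.prems(3)[of j] A[of j] that by auto
      qed
      then show "tensor k (w(n := w n)) \<in> vecs (tensor_idx I k)"
        by (auto intro: tensor_in_vecs)
      show "tensor k (w(n := a)) \<in> affine_closure (tensor_idx I k) B" if "a \<in> A n" for a
        by (rule Suc.IH) (use Suc.prems that in auto)
    qed
    then show ?case by simp
  qed
  from this[of k v] v show ?thesis by simp
qed

section \<open>Secant varieties as closures of sumsets\<close>

text \<open>
  The origin is included so that a sum of at most \<open>n\<close> vectors can be padded to exactly \<open>n\<close>.
\<close>

definition cone_over :: "'i point set \<Rightarrow> ('i \<Rightarrow> complex) set" where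
  "cone_over X = insert 0 (\<Union>X)"

definition sumset :: "nat \<Rightarrow> ('i \<Rightarrow> complex) set \<Rightarrow> ('i \<Rightarrow> complex) set" where
  "sumset n C = {\<Sum>j<n. x j | x. \<forall>j<n. x j \<in> C}"

lemma zero_in_cone_over: "0 \<in> cone_over X"
  by (simp add: cone_over_def)

lemma sum_fun_apply: "(\<Sum>j\<in>A. f j) i = (\<Sum>j\<in>A. f j i)"
  for f :: "'j \<Rightarrow> 'i \<Rightarrow> complex"
  by (induction A rule: infinite_finite_induct) auto

lemma sumset_vecs: "C \<subseteq> vecs I \<Longrightarrow> sumset n C \<subseteq> vecs I"
  by (force simp: sumset_def vecs_def sum_fun_apply intro!: sum.neutral)

lemma sumset_finite:
  assumes "finite T" "\<And>i. i \<in> T \<Longrightarrow> x i \<in> C"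
  shows "(\<Sum>i\<in>T. x i) \<in> sumset (card T) C"
proof -
  obtain h where h: "bij_betw h {..<card T} T"
    using ex_bij_betw_nat_finite[OF assms(1)] by (auto simp: atLeast0LessThan)
  have "(\<Sum>i\<in>T. x i) = (\<Sum>j<card T. x (h j))" by (rule sum.reindex_bij_betw[OF h, symmetric])
  moreover have "\<forall>j<card T. x (h j) \<in> C" using assms(2) h by (auto simp: bij_betw_def)
  ultimately show ?thesis by (auto simp: sumset_def)
qed

lemma sumset_add:
  assumes "v \<in> sumset m C" "w \<in> sumset n C"
  shows "v + w \<in> sumset (m + n) C"
proof -
  obtain x y where x: "v = (\<Sum>j<m. x j)" "\<forall>j<m. x j \<in> C"
    and y: "w = (\<Sum>j<n. y j)" "\<forall>j<n. y j \<in> C"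
    using assms by (auto simp: sumset_def)
  have "v + w = (\<Sum>i\<in>{..<m} <+> {..<n}. case_sum x y i)"
    by (subst sum.Plus) (simp_all add: x y)
  also have "\<dots> \<in> sumset (card ({..<m} <+> {..<n})) C"
    by (rule sumset_finite) (use x y in auto)
  finally show ?thesis by (simp add: card_Plus)
qed

lemma sumset_cscale:
  assumes cone: "\<And>t a. a \<in> C \<Longrightarrow> cscale t a \<in> C" and "v \<in> sumset n C"
  shows "cscale t v \<in> sumset n C"
proof -
  obtain x where x: "v = (\<Sum>j<n. x j)" "\<forall>j<n. x j \<in> C" using assms by (auto simp: sumset_def)
  have "cscale t v = (\<Sum>j<n. cscale t (x j))"
    by (simp add: x cvec.scale_sum_right)
  with x cone show ?thesis by (auto simp: sumset_def)
qed

lemma zero_in_sumset: "0 \<in> C \<Longrightarrow> 0 \<in> sumset n C"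
  by (auto simp: sumset_def intro!: exI[of _ "\<lambda>_. 0"])

lemma sumset_mono:
  assumes "0 \<in> C" "m \<le> n"
  shows "sumset m C \<subseteq> sumset n C"
proof
  fix v assume "v \<in> sumset m C"
  from sumset_add[OF this zero_in_sumset[OF assms(1), of "n - m"]] assms(2)
  show "v \<in> sumset n C" by simp
qed

lemma sumset_one: "C \<subseteq> sumset 1 C"
  by (force simp: sumset_def)

lemma affine_closure_sumset_add:
  assumes "C \<subseteq> vecs I"
    and "v \<in> affine_closure I (sumset m C)" "w \<in> affine_closure I (sumset n C)"
  shows "v + w \<in> affine_closure I (sumset (m + n) C)"
  using affine_closure_superset[OF sumset_vecs[OF assms(1)]]
  by (intro affine_closure_add[OF assms(2,3)] sumset_vecs[OF assms(1)]) (blast intro: sumset_add)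

lemma affine_closure_sumset_sum:
  assumes "C \<subseteq> vecs I" "finite T"
    and "\<And>s. s \<in> T \<Longrightarrow> v s \<in> affine_closure I (sumset (n s) C)"
  shows "(\<Sum>s\<in>T. v s) \<in> affine_closure I (sumset (\<Sum>s\<in>T. n s) C)"
  using assms(2,3)
proof (induction T)
  case empty
  have "0 \<in> sumset 0 C" by (simp add: sumset_def)
  then show ?case unfolding sum.empty
    using affine_closure_superset[OF sumset_vecs[OF assms(1)]] by blast
next
  case (insert s T)
  then show ?case
    unfolding sum.insert[OF insert.hyps(1,2)]
    by (intro affine_closure_sumset_add[OF assms(1)]) simp_all
qed

lemma proj_pt_self: "v \<in> proj_pt v"
  by (auto simp: proj_pt_def cscale_def intro!: exI[of _ 1])

lemma proj_pt_cscale: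
  assumes "c \<noteq> 0"
  shows "proj_pt (cscale c v) = proj_pt v"
proof (intro equalityI subsetI)
  fix u assume "u \<in> proj_pt (cscale c v)"
  then obtain d where "d \<noteq> 0" "u = cscale d (cscale c v)" by (auto simp: proj_pt_def)
  then have "d * c \<noteq> 0" "u = cscale (d * c) v" using assms by simp_all
  then show "u \<in> proj_pt v" unfolding proj_pt_def by blast
next
  fix u assume "u \<in> proj_pt v"
  then obtain d where "d \<noteq> 0" "u = cscale d v" by (auto simp: proj_pt_def)
  then have "d / c \<noteq> 0" "u = cscale (d / c) (cscale c v)" using assms by simp_all
  then show "u \<in> proj_pt (cscale c v)" unfolding proj_pt_def by blast
qed

lemma proj_ptD: "u \<in> proj_pt v \<Longrightarrow> \<exists>c. c \<noteq> 0 \<and> u = cscale c v"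
  by (auto simp: proj_pt_def)

lemma proj_pt_eqI: "u \<in> proj_pt v \<Longrightarrow> proj_pt u = proj_pt v"
  using proj_ptD proj_pt_cscale by blast

lemma proj_pt_in_space: "v \<in> vecs I \<Longrightarrow> v \<noteq> 0 \<Longrightarrow> proj_pt v \<in> proj_space I"
  by (auto simp: proj_space_def)

lemma cscale_nonzero: "c \<noteq> 0 \<Longrightarrow> v \<noteq> 0 \<Longrightarrow> cscale c v \<noteq> 0"
  using cvec.scale_eq_0_iff by blast

lemma cone_over_cscale:
  assumes "X \<subseteq> proj_space I" "a \<in> cone_over X"
  shows "cscale t a \<in> cone_over X"
proof (cases "t = 0 \<or> a = 0")
  case True
  then have "cscale t a = 0" by (auto simp: cscale_def)
  then show ?thesis by (simp add: cone_over_def)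
next
  case False
  with assms obtain P where P: "P \<in> X" "a \<in> P" by (auto simp: cone_over_def)
  then obtain v where "P = proj_pt v" using assms by (auto simp: proj_space_def)
  then have "P = proj_pt a" using P proj_pt_eqI by blast
  then have "cscale t a \<in> P" using False by (auto simp: proj_pt_def)
  with P show ?thesis by (auto simp: cone_over_def)
qed

lemma cone_over_vecs: "X \<subseteq> proj_space I \<Longrightarrow> cone_over X \<subseteq> vecs I"
  by (force simp: cone_over_def proj_space_def proj_pt_def vecs_def cscale_def)

lemma enat_Inf_attained: "A \<noteq> {} \<Longrightarrow> Inf A \<in> A" for A :: "enat set"
  unfolding Inf_enat_def using LeastI[of "\<lambda>x. x \<in> A"] by auto

text \<open>
  A vector in the span of \<open>s\<close> points is a linear combination of one representative of each; since
  the set of representatives is closed under scaling, the coefficients can be absorbed. The rank may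
  be less than \<open>r\<close>, and the missing summands are then zero.
\<close>

lemma X_rank_le_imp_sumset:
  assumes X: "X \<subseteq> proj_space I" and "X_rank X (proj_pt v) \<le> enat r"
  shows "v \<in> sumset r (cone_over X)"
proof -
  let ?R = "{r. \<exists>z. (\<forall>j\<in>{1..r}. z j \<in> X) \<and> proj_pt v \<in> proj_span (z ` {1..r})}"
  have ne: "enat ` ?R \<noteq> {}"
  proof
    assume "enat ` ?R = {}"
    then have "X_rank X (proj_pt v) = \<infinity>" unfolding X_rank_def Inf_enat_def by simp
    with assms(2) show False by simp
  qed
  have "X_rank X (proj_pt v) \<in> enat ` ?R"
    unfolding X_rank_def using ne by (rule enat_Inf_attained)
  then obtain s where s: "s \<in> ?R" "X_rank X (proj_pt v) = enat s" by blast
  then have "s \<le> r" using assms(2) by simp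
  obtain z where z: "\<forall>j\<in>{1..s}. z j \<in> X" "proj_pt v \<in> proj_span (z ` {1..s})"
    using s(1) by blast
  have zpt: "\<exists>u. z j = proj_pt u" if "j \<in> {1..s}" for j
    using z(1) X that unfolding proj_space_def by blast
  then obtain u where u: "\<And>j. j \<in> {1..s} \<Longrightarrow> z j = proj_pt (u j)" by metis
  let ?S = "{\<Sum>j\<in>{1..s}. cscale (c j) (u j) | c. True}"
  have sub: "cvec.subspace ?S"
  proof (rule cvec.subspaceI)
    show "0 \<in> ?S" by (auto intro!: exI[of _ "\<lambda>_. 0"])
    fix x y assume xy: "x \<in> ?S" "y \<in> ?S"
    show "x + y \<in> ?S"
    proof -
      obtain c d where "x = (\<Sum>j\<in>{1..s}. cscale (c j) (u j))" "y = (\<Sum>j\<in>{1..s}. cscale (d j) (u j))"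
        using xy by blast
      then have "x + y = (\<Sum>j\<in>{1..s}. cscale (c j + d j) (u j))"
        by (simp add: cvec.scale_left_distrib sum.distrib)
      then show ?thesis by (intro CollectI exI[of _ "\<lambda>j. c j + d j"]) simp
    qed
    show "cscale t x \<in> ?S" if x: "x \<in> ?S" for t x
    proof -
      obtain c where "x = (\<Sum>j\<in>{1..s}. cscale (c j) (u j))" using x by blast
      then have "cscale t x = (\<Sum>j\<in>{1..s}. cscale (t * c j) (u j))"
        by (simp add: cvec.scale_sum_right)
      then show ?thesis by (intro CollectI exI[of _ "\<lambda>j. t * c j"]) simp
    qed
  qed
  have "\<Union>(z ` {1..s}) \<subseteq> ?S"
  proof
    fix x assume "x \<in> \<Union>(z ` {1..s})"
    then obtain i where i: "i \<in> {1..s}" "x \<in> z i" by blast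
    then obtain c where i: "i \<in> {1..s}" "x = cscale c (u i)" using u proj_ptD by metis
    have "(\<Sum>j\<in>{1..s}. cscale (if j = i then c else 0) (u j)) = (\<Sum>j\<in>{1..s}. if j = i then x else 0)"
      by (rule sum.cong) (auto simp: i)
    then have "x = (\<Sum>j\<in>{1..s}. cscale (if j = i then c else 0) (u j))" using i by simp
    then show "x \<in> ?S" by (intro CollectI exI[of _ "\<lambda>j. if j = i then c else 0"]) simp
  qed
  then have span: "cspan (\<Union>(z ` {1..s})) \<subseteq> ?S"
    using sub by (rule cvec.span_minimal)
  obtain w where w: "w \<in> cspan (\<Union>(z ` {1..s}))" "proj_pt v = proj_pt w"
    using z(2) by (auto simp: proj_span_def)
  obtain t where t: "v = cscale t w" using proj_pt_self[of v] w(2) proj_ptD by blast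
  have "v \<in> cspan (\<Union>(z ` {1..s}))" using w(1) t cvec.span_scale by blast
  then obtain c where "v = (\<Sum>j\<in>{1..s}. cscale (c j) (u j))" using span by blast
  moreover have "cscale (c j) (u j) \<in> cone_over X" if "j \<in> {1..s}" for j
  proof -
    have "z j \<in> X" "u j \<in> z j" using z(1) u[OF that] that proj_pt_self by blast+
    then have "u j \<in> cone_over X" unfolding cone_over_def by blast
    then show ?thesis using X cone_over_cscale by blast
  qed
  ultimately have "v \<in> sumset (card {1..s}) (cone_over X)"
    using sumset_finite[of "{1..s}" "\<lambda>j. cscale (c j) (u j)"] by simp
  with \<open>s \<le> r\<close> show ?thesis using sumset_mono[OF zero_in_cone_over, of s r] by auto
qed

text \<open>
  A summand of a vector in the sumset may be zero, and then it comes from no point of \<open>X\<close>; since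
  \<open>X\<close> is nonempty, any point can stand in for it without harm to the span.
\<close>

lemma sumset_imp_X_rank_le:
  assumes "v \<in> sumset r (cone_over X)" "v \<noteq> 0" "X \<noteq> {}"
  shows "X_rank X (proj_pt v) \<le> enat r"
proof -
  obtain x where x: "v = (\<Sum>j<r. x j)" "\<forall>j<r. x j \<in> cone_over X"
    using assms(1) by (auto simp: sumset_def)
  have "\<exists>P\<in>X. x j \<in> insert 0 P" if "j < r" for j
    using x(2) that assms(3) by (auto simp: cone_over_def)
  then obtain P where P: "\<And>j. j < r \<Longrightarrow> P j \<in> X \<and> x j \<in> insert 0 (P j)" by metis
  let ?z = "\<lambda>j. P (j - 1)"
  have Pz: "P j \<in> ?z ` {1..r}" if "j < r" for j
    using that by (intro image_eqI[of _ _ "Suc j"]) auto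
  have "x j \<in> cspan (\<Union>(?z ` {1..r}))" if "j < r" for j
  proof (cases "x j = 0")
    case True
    then show ?thesis using cvec.span_zero by metis
  next
    case False
    then have "x j \<in> \<Union>(?z ` {1..r})" using P[OF that] Pz[OF that] by blast
    then show ?thesis by (rule cvec.span_base)
  qed
  then have "v \<in> cspan (\<Union>(?z ` {1..r}))"
    unfolding x(1) by (intro cvec.span_sum) auto
  then have "proj_pt v \<in> proj_span (?z ` {1..r})" using assms(2) by (auto simp: proj_span_def)
  moreover have "\<forall>j\<in>{1..r}. ?z j \<in> X" using P by auto
  ultimately show ?thesis unfolding X_rank_def
    by (intro INF_lower) (auto intro!: exI[of _ ?z])
qed

text \<open>
  With its converse below, this identifies the secant variety with the Zariski closure of the
  sumset. The projective equations of the points of rank at most \<open>r\<close> control the sumset only away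
  from the origin; homogeneity, together with a nonzero vector in the sumset, extends them to it.
\<close>

lemma affine_closure_imp_secant:
  assumes X: "X \<subseteq> proj_space I" "X \<noteq> {}" "r \<ge> 1"
    and v: "v \<in> affine_closure I (sumset r (cone_over X))" "v \<noteq> 0"
  shows "proj_pt v \<in> secant_variety I r X"
proof -
  let ?S = "{p \<in> proj_space I. X_rank X p \<le> enat r}"
  have "proj_pt v \<in> Z" if Z: "proj_variety I Z" "?S \<subseteq> Z" for Z
  proof -
    obtain S where S: "\<forall>f\<in>S. \<exists>d. homogeneous I d f" "Z = zero_locus I S"
      using Z(1) by (auto simp: proj_variety_def)
    have "mpoly_eval f u = 0" if f: "f \<in> S" and u: "u \<in> proj_pt v" for f u
    proof -
      obtain d where d: "homogeneous I d f" using S f by blast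
      have van: "mpoly_eval f a = 0" if "a \<in> sumset r (cone_over X)" "a \<noteq> 0" for a
      proof -
        have "a \<in> vecs I" using that sumset_vecs[OF cone_over_vecs[OF X(1)]] by blast
        then have "proj_pt a \<in> Z"
          using Z(2) that proj_pt_in_space sumset_imp_X_rank_le X(2) by blast
        then show ?thesis using S f proj_pt_self by (auto simp: zero_locus_def)
      qed
      \<comment> \<open>The origin lies on the line through any nonzero vector of the sumset.\<close>
      obtain P where P: "P \<in> X" using X by blast
      then obtain w where w: "P = proj_pt w" "w \<noteq> 0" using X(1) by (auto simp: proj_space_def)
      have "w \<in> cone_over X" using P w proj_pt_self by (auto simp: cone_over_def)
      then have "w \<in> sumset 1 (cone_over X)" by (rule subsetD[OF sumset_one])
      then have "w \<in> sumset r (cone_over X)"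
        using sumset_mono[OF zero_in_cone_over X(3)] by blast
      then have "mpoly_eval f (cscale 0 w) = 0"
        unfolding mpoly_eval_cscale[OF d] using van w(2) by simp
      then have "\<forall>a\<in>sumset r (cone_over X). mpoly_eval f a = 0" using van by (metis cvec.scale_zero_left)
      then have "mpoly_eval f v = 0"
        using v(1) polyfun_mpoly_eval[OF d] by (auto simp: affine_closure_def)
      then show ?thesis using u d by (auto dest!: proj_ptD simp: mpoly_eval_cscale)
    qed
    moreover have "proj_pt v \<in> proj_space I"
      using v by (auto simp: affine_closure_def intro: proj_pt_in_space)
    ultimately show ?thesis by (auto simp: S zero_locus_def)
  qed
  then show ?thesis by (auto simp: secant_variety_def zariski_closure_def)
qed

lemma proj_variety_space: "proj_variety I (proj_space I)"
  by (auto simp: proj_variety_def zero_locus_def intro!: exI[of _ "{}"])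

lemma secant_imp_affine_closure:
  assumes X: "X \<subseteq> proj_space I" and p: "proj_pt v \<in> secant_variety I r X" and "v \<in> vecs I"
  shows "v \<in> affine_closure I (sumset r (cone_over X))"
proof (rule affine_closure_cone)
  let ?S = "{p \<in> proj_space I. X_rank X p \<le> enat r}"
  show "cscale t a \<in> sumset r (cone_over X)" if "a \<in> sumset r (cone_over X)" for t a
    using that sumset_cscale cone_over_cscale[OF X] by blast
  fix d F assume F: "homogeneous I d F" "\<forall>a\<in>sumset r (cone_over X). mpoly_eval F a = 0"
  have "?S \<subseteq> zero_locus I {F}"
  proof
    fix P assume P: "P \<in> ?S"
    then obtain w where w: "P = proj_pt w" by (auto simp: proj_space_def)
    have "mpoly_eval F u = 0" if "u \<in> P" for u
    proof -
      have "P = proj_pt u" using w that proj_pt_eqI by blast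
      then show ?thesis using X_rank_le_imp_sumset[OF X] P F(2) by auto
    qed
    with P show "P \<in> zero_locus I {F}" by (auto simp: zero_locus_def)
  qed
  moreover have "proj_variety I (zero_locus I {F})"
    using F(1) unfolding proj_variety_def by (intro exI[of _ "{F}"]) auto
  ultimately have "proj_pt v \<in> zero_locus I {F}"
    using p by (auto simp: secant_variety_def zariski_closure_def)
  then show "mpoly_eval F v = 0" using proj_pt_self by (auto simp: zero_locus_def)
qed (fact assms(3))

lemma secant_subset_proj_space: "secant_variety I r X \<subseteq> proj_space I"
  using proj_variety_space unfolding secant_variety_def zariski_closure_def by blast

lemma secant_mono: "s \<le> r \<Longrightarrow> secant_variety I s X \<subseteq> secant_variety I r X"
proof -
  assume "s \<le> r"
  then have "{p \<in> proj_space I. X_rank X p \<le> enat s} \<subseteq> {p \<in> proj_space I. X_rank X p \<le> enat r}"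
    by (auto intro: order_trans)
  then show ?thesis unfolding secant_variety_def zariski_closure_def by blast
qed

section \<open>Tensor powers\<close>

lemma tensor_cong: "(\<And>j. j < k \<Longrightarrow> v j = w j) \<Longrightarrow> tensor k v = tensor k w"
  by (auto simp: tensor_def fun_eq_iff)

lemma tensor_cscale:
  "tensor k (\<lambda>j. cscale (c j) (v j)) = cscale (\<Prod>j<k. c j) (tensor k v)"
  by (auto simp: tensor_def cscale_def fun_eq_iff prod.distrib)

lemma tensor_nonzero:
  assumes "\<And>j. j < k \<Longrightarrow> v j \<noteq> 0"
  shows "tensor k v \<noteq> 0"
proof -
  have "\<exists>i. j < k \<longrightarrow> v j i \<noteq> 0" for j using assms[of j] by (auto simp: fun_eq_iff)
  then obtain i where "\<And>j. j < k \<Longrightarrow> v j (i j) \<noteq> 0" by metis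
  then have "tensor k v (map i [0..<k]) \<noteq> 0" by (simp add: tensor_def)
  then show ?thesis by auto
qed

lemma tensor_power_pt_proj_pt: "tensor_power_pt k (proj_pt v) = proj_pt (tensor k (\<lambda>_. v))"
proof -
  have "proj_pt (tensor k (\<lambda>_. u)) = proj_pt (tensor k (\<lambda>_. v))" if u: "u \<in> proj_pt v" for u
  proof -
    obtain c where c: "c \<noteq> 0" "u = cscale c v" using proj_ptD[OF u] by blast
    then show ?thesis by (simp add: tensor_cscale proj_pt_cscale)
  qed
  then show ?thesis using proj_pt_self[of v] unfolding tensor_power_pt_def by blast
qed

lemma segre_proj_pt:
  assumes "\<And>j. j < k \<Longrightarrow> P j = proj_pt (u j)"
  shows "segre k P = proj_pt (tensor k u)"
proof -
  have "proj_pt (tensor k v) = proj_pt (tensor k u)" if v: "v \<in> PiE {..<k} P" for v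
  proof -
    have "\<exists>c. j < k \<longrightarrow> c \<noteq> 0 \<and> v j = cscale c (u j)" for j
      using v assms[of j] proj_ptD[of "v j" "u j"] by (auto simp: PiE_def Pi_def)
    then obtain c where c: "\<And>j. j < k \<Longrightarrow> c j \<noteq> 0 \<and> v j = cscale (c j) (u j)" by metis
    then have "tensor k v = cscale (\<Prod>j<k. c j) (tensor k u)"
      by (subst tensor_cscale[symmetric]) (auto intro: tensor_cong)
    moreover have "(\<Prod>j<k. c j) \<noteq> 0" using c by simp
    ultimately show ?thesis by (simp add: proj_pt_cscale)
  qed
  moreover have "restrict u {..<k} \<in> PiE {..<k} P" using assms proj_pt_self by auto
  ultimately show ?thesis unfolding segre_def by blast
qed

lemma segre_power_in_proj_space:
  assumes "X \<subseteq> proj_space I"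
  shows "segre_power k X \<subseteq> proj_space (tensor_idx I k)"
proof
  fix Q assume "Q \<in> segre_power k X"
  then obtain P where P: "Q = segre k P" "\<And>j. j < k \<Longrightarrow> P j \<in> X"
    by (auto simp: segre_power_def)
  have "\<exists>u. j < k \<longrightarrow> P j = proj_pt u \<and> u \<in> vecs I \<and> u \<noteq> 0" for j
    using P(2)[of j] assms by (auto simp: proj_space_def)
  then obtain u where u: "\<And>j. j < k \<Longrightarrow> P j = proj_pt (u j) \<and> u j \<in> vecs I \<and> u j \<noteq> 0" by metis
  then have "Q = proj_pt (tensor k u)" by (simp add: P segre_proj_pt)
  moreover have "tensor k u \<in> vecs (tensor_idx I k)" "tensor k u \<noteq> 0"
    using u by (auto intro!: tensor_in_vecs tensor_nonzero)
  ultimately show "Q \<in> proj_space (tensor_idx I k)" by (simp add: proj_pt_in_space)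
qed

lemma tensor_in_cone_over_segre_power:
  assumes X: "X \<subseteq> proj_space I" and a: "\<And>j. j < k \<Longrightarrow> a j \<in> cone_over X"
  shows "tensor k a \<in> cone_over (segre_power k X)"
proof (cases "\<exists>j<k. a j = 0")
  case True
  then obtain j where j: "j < k" "a j = 0" by blast
  have "tensor k a = 0" using j by (auto simp: tensor_def fun_eq_iff intro!: bexI[of _ j])
  then show ?thesis by (simp add: cone_over_def)
next
  case False
  have "proj_pt (a j) \<in> X" if j: "j < k" for j
  proof -
    obtain P where P: "P \<in> X" "a j \<in> P" using a[OF j] False j by (auto simp: cone_over_def)
    then obtain v where "P = proj_pt v" using X by (auto simp: proj_space_def)
    then show ?thesis using P proj_pt_eqI by metis
  qed
  then have "restrict (\<lambda>j. proj_pt (a j)) {..<k} \<in> PiE {..<k} (\<lambda>_. X)" by auto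
  moreover have "segre k (restrict (\<lambda>j. proj_pt (a j)) {..<k}) = proj_pt (tensor k a)"
    by (rule segre_proj_pt) simp
  ultimately have "proj_pt (tensor k a) \<in> segre_power k X"
    unfolding segre_power_def by (metis imageI)
  then show ?thesis using proj_pt_self by (auto simp: cone_over_def)
qed

text \<open>
  Multilinear expansion: the product of sums of \<open>s j\<close> vectors has one term for each choice of a
  summand in every factor.
\<close>

lemma tensor_in_sumset:
  assumes X: "X \<subseteq> proj_space I" and a: "\<And>j. j < k \<Longrightarrow> a j \<in> sumset (s j) (cone_over X)"
  shows "tensor k a \<in> sumset (\<Prod>j<k. s j) (cone_over (segre_power k X))"
proof -
  have "\<exists>x. j < k \<longrightarrow> a j = (\<Sum>i<s j. x i) \<and> (\<forall>i<s j. x i \<in> cone_over X)" for j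
    using a[of j] by (auto simp: sumset_def)
  then obtain x where x: "\<And>j. j < k \<Longrightarrow> a j = (\<Sum>i<s j. x j i) \<and> (\<forall>i<s j. x j i \<in> cone_over X)"
    by metis
  let ?G = "PiE {..<k} (\<lambda>j. {..<s j})"
  have "tensor k a is = (\<Sum>g\<in>?G. tensor k (\<lambda>j. x j (g j))) is" for "is"
  proof (cases "length is = k")
    case True
    then have "tensor k a is = (\<Prod>j<k. \<Sum>i<s j. x j i (is ! j))"
      using x by (simp add: tensor_def sum_fun_apply)
    also have "\<dots> = (\<Sum>g\<in>?G. \<Prod>j<k. x j (g j) (is ! j))" by (rule prod_sum_PiE) auto
    finally show ?thesis using True by (simp add: sum_fun_apply tensor_def)
  qed (simp add: tensor_def sum_fun_apply)
  then have "tensor k a = (\<Sum>g\<in>?G. tensor k (\<lambda>j. x j (g j)))" by blast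
  also have "\<dots> \<in> sumset (card ?G) (cone_over (segre_power k X))"
  proof (rule sumset_finite)
    show "finite ?G" by (intro finite_PiE) auto
    show "tensor k (\<lambda>j. x j (g j)) \<in> cone_over (segre_power k X)" if "g \<in> ?G" for g
    proof (rule tensor_in_cone_over_segre_power[OF X])
      show "x j (g j) \<in> cone_over X" if "j < k" for j
        using x[OF that] \<open>g \<in> ?G\<close> that by (auto simp: PiE_def Pi_def)
    qed
  qed
  finally show ?thesis by (simp add: card_PiE)
qed

lemma tensor_in_affine_closure_sumset:
  assumes X: "X \<subseteq> proj_space I"
    and v: "\<And>j. j < k \<Longrightarrow> v j \<in> affine_closure I (sumset (s j) (cone_over X))"
  shows "tensor k v \<in>
    affine_closure (tensor_idx I k) (sumset (\<Prod>j<k. s j) (cone_over (segre_power k X)))"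
proof (rule affine_closure_tensor[OF v])
  show "sumset (s j) (cone_over X) \<subseteq> vecs I" for j
    using X by (intro sumset_vecs cone_over_vecs)
  show "tensor k a \<in>
      affine_closure (tensor_idx I k) (sumset (\<Prod>j<k. s j) (cone_over (segre_power k X)))"
    if a: "\<And>j. j < k \<Longrightarrow> a j \<in> sumset (s j) (cone_over X)" for a
  proof (rule subsetD[OF affine_closure_superset])
    show "sumset (\<Prod>j<k. s j) (cone_over (segre_power k X)) \<subseteq> vecs (tensor_idx I k)"
      by (intro sumset_vecs cone_over_vecs segre_power_in_proj_space X)
    show "tensor k a \<in> sumset (\<Prod>j<k. s j) (cone_over (segre_power k X))"
      by (rule tensor_in_sumset[OF X]) (rule a)
  qed
qed

section \<open>Splitting off the odd part of a tensor power\<close>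

text \<open>
  In the expansions of the two products over the set \<open>S\<close> of factors contributing \<open>a\<close>, the terms
  differ by the sign \<open>(-1)\<close> to the power \<open>|S|\<close>. Only odd \<open>S\<close> survive in the difference, twice each.
\<close>

lemma prod_add_odd_part:
  fixes a b :: "'j \<Rightarrow> 'c :: comm_ring_1"
  assumes "finite A"
  shows "(\<Prod>i\<in>A. b i + a i) = (\<Prod>i\<in>A. b i - a i) +
    (\<Sum>S\<in>{S \<in> Pow A. odd (card S)}. 2 * (\<Prod>i\<in>A. if i \<in> S then a i else b i))"
proof -
  let ?p = "\<lambda>S. (\<Prod>i\<in>S. a i) * (\<Prod>i\<in>A - S. b i)"
  have "(\<Prod>i\<in>A. b i + a i) - (\<Prod>i\<in>A. b i - a i) =
      (\<Sum>S\<in>Pow A. ?p S) - (\<Sum>S\<in>Pow A. (-1) ^ card S * ?p S)"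
    using prod_add[OF assms, of a b] prod_diff_conv_sum[OF assms, of b a]
    by (simp add: add.commute mult.assoc)
  also have "\<dots> = (\<Sum>S\<in>Pow A. if odd (card S) then 2 * ?p S else 0)"
    by (subst sum_subtractf[symmetric], rule sum.cong) auto
  also have "\<dots> = (\<Sum>S\<in>{S \<in> Pow A. odd (card S)}. 2 * ?p S)"
    using assms by (intro sum.inter_filter[symmetric]) simp
  also have "\<dots> = (\<Sum>S\<in>{S \<in> Pow A. odd (card S)}. 2 * (\<Prod>i\<in>A. if i \<in> S then a i else b i))"
  proof (rule sum.cong)
    fix S assume "S \<in> {S \<in> Pow A. odd (card S)}"
    then have "A \<inter> S = S" "A \<inter> - S = A - S" by auto
    then show "2 * ?p S = 2 * (\<Prod>i\<in>A. if i \<in> S then a i else b i)"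
      using assms by (simp add: prod.If_cases)
  qed simp
  finally show ?thesis by (simp add: algebra_simps)
qed

lemma tensor_power_odd_part:
  "tensor k (\<lambda>_. m + z) = tensor k (\<lambda>_. m - z) +
    (\<Sum>S\<in>{S \<in> Pow {..<k}. odd (card S)}. cscale 2 (tensor k (\<lambda>j. if j \<in> S then z else m)))"
proof
  fix "is" :: "'a list"
  show "tensor k (\<lambda>_. m + z) is = (tensor k (\<lambda>_. m - z) +
    (\<Sum>S\<in>{S \<in> Pow {..<k}. odd (card S)}. cscale 2 (tensor k (\<lambda>j. if j \<in> S then z else m)))) is"
  proof (cases "length is = k")
    case True
    have *: "(if j \<in> S then z else m) (is ! j) = (if j \<in> S then z (is ! j) else m (is ! j))" for j S
      by simp
    show ?thesis
      using True prod_add_odd_part[of "{..<k}" "\<lambda>j. m (is ! j)" "\<lambda>j. z (is ! j)"]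
      by (simp add: tensor_def sum_fun_apply cscale_def *)
  qed (simp add: tensor_def sum_fun_apply cscale_def)
qed

text \<open>
  A bound for the border rank of the right side of \<open>tensor_power_odd_part\<close>: the first summand has
  border rank at most \<open>r\<^sup>k\<close>, and in the others each slot contributes a factor \<open>1\<close> if it carries
  a point of the variety and a factor \<open>r\<close> otherwise.
\<close>

definition odd_count :: "nat \<Rightarrow> nat \<Rightarrow> nat" where
  "odd_count r k = r ^ k +
    (\<Sum>S\<in>{S \<in> Pow {..<k}. odd (card S)}. \<Prod>j<k. if j \<in> S then 1 else r)"

lemma odd_count_eq:
  "real (odd_count r k) = 1 / 2 * ((real r + 1) ^ k + 2 * real r ^ k - (real r - 1) ^ k)"
proof -
  have "real (\<Prod>j<k. if j \<in> S then 1 else r) = (\<Prod>j<k. if j \<in> S then 1 else real r)" for S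
    by (simp add: if_distrib cong: if_cong)
  then show ?thesis
    using prod_add_odd_part[of "{..<k}" "\<lambda>_. real r" "\<lambda>_. 1"]
    by (simp add: odd_count_def sum_distrib_left[symmetric])
qed

text \<open>
  The difference of the two sides is half of \<open>(r + 1)\<^sup>k + (r - 1)\<^sup>k - 2 r\<^sup>k\<close>, which is positive by
  strict convexity of the \<open>k\<close>-th power.
\<close>

lemma odd_count_less:
  assumes "r \<ge> 2" "k \<ge> 2"
  shows "1 / 2 * ((real r + 1) ^ k + 2 * real r ^ k - (real r - 1) ^ k) < (real r + 1) ^ k"
proof -
  have "2 * real r ^ k < (real r + 1) ^ k + (real r - 1) ^ k"
    using assms(2)
  proof (induction k rule: dec_induct)
    case base
    then show ?case by (simp add: power2_eq_square algebra_simps)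
  next
    case (step k)
    have "(real r - 1) ^ k \<le> (real r + 1) ^ k" using assms(1) by (intro power_mono) auto
    moreover have "real r * (2 * real r ^ k) < real r * ((real r + 1) ^ k + (real r - 1) ^ k)"
      using step.IH assms(1) by (intro mult_strict_left_mono) auto
    ultimately show ?case by (simp add: algebra_simps)
  qed
  then show ?thesis by simp
qed

lemma tensor_power_in_secant:
  assumes X: "X \<subseteq> proj_space I"
    and z: "z \<in> cone_over X"
    and m: "m \<in> affine_closure I (sumset r (cone_over X))"
    and mz: "m - z \<in> affine_closure I (sumset r (cone_over X))"
  shows "tensor k (\<lambda>_. m + z) \<in>
    affine_closure (tensor_idx I k) (sumset (odd_count r k) (cone_over (segre_power k X)))"
proof -
  let ?Y = "segre_power k X" and ?J = "tensor_idx I k"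
  have Y: "cone_over ?Y \<subseteq> vecs ?J" by (intro cone_over_vecs segre_power_in_proj_space X)
  have z': "z \<in> affine_closure I (sumset 1 (cone_over X))"
    using z sumset_one affine_closure_superset[OF sumset_vecs[OF cone_over_vecs[OF X]]] by blast
  have base: "tensor k (\<lambda>_. m - z) \<in> affine_closure ?J (sumset (r ^ k) (cone_over ?Y))"
    using tensor_in_affine_closure_sumset[OF X, of k "\<lambda>_. m - z" "\<lambda>_. r"] mz by simp
  have "cscale 2 (tensor k (\<lambda>j. if j \<in> S then z else m)) \<in>
      affine_closure ?J (sumset (\<Prod>j<k. if j \<in> S then 1 else r) (cone_over ?Y))" for S
  proof (rule affine_closure_cscale)
    show "cscale t a \<in> sumset n (cone_over ?Y)" if "a \<in> sumset n (cone_over ?Y)" for t a n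
      using that sumset_cscale cone_over_cscale[OF segre_power_in_proj_space[OF X]] by blast
    show "tensor k (\<lambda>j. if j \<in> S then z else m) \<in>
        affine_closure ?J (sumset (\<Prod>j<k. if j \<in> S then 1 else r) (cone_over ?Y))"
      by (rule tensor_in_affine_closure_sumset[OF X]) (use z' m in auto)
  qed (rule sumset_vecs[OF Y])
  then have "(\<Sum>S\<in>{S \<in> Pow {..<k}. odd (card S)}. cscale 2 (tensor k (\<lambda>j. if j \<in> S then z else m)))
    \<in> affine_closure ?J (sumset (\<Sum>S\<in>{S \<in> Pow {..<k}. odd (card S)}.
        \<Prod>j<k. if j \<in> S then 1 else r) (cone_over ?Y))"
    by (intro affine_closure_sumset_sum[OF Y]) auto
  from affine_closure_sumset_add[OF Y base this] show ?thesis
    unfolding tensor_power_odd_part odd_count_def .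
qed

section \<open>The point on the line\<close>

text \<open>
  Two distinct points of a line span it: three independent vectors do not fit into the span of the
  two vectors that define the line.
\<close>

lemma line_coordinates:
  assumes L: "is_line I L" and "proj_pt z \<in> L" "proj_pt q \<in> L" "proj_pt z \<noteq> proj_pt q"
    and "proj_pt x \<in> L"
  shows "\<exists>s t. x = cscale s z + cscale t q"
proof -
  obtain a b where ab: "L = proj_span {proj_pt a, proj_pt b}"
    using L by (auto simp: is_line_def proj_space_def)
  have span: "y \<in> cspan {a, b} \<and> y \<noteq> 0" if y: "proj_pt y \<in> L" for y
  proof -
    obtain w where w: "proj_pt y = proj_pt w" "w \<in> cspan (proj_pt a \<union> proj_pt b)" "w \<noteq> 0"
      using y unfolding ab proj_span_def by auto
    have "proj_pt a \<union> proj_pt b \<subseteq> cspan {a, b}"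
      by (auto dest!: proj_ptD intro!: cvec.span_scale intro: cvec.span_base)
    then have "cspan (proj_pt a \<union> proj_pt b) \<subseteq> cspan {a, b}"
      by (rule cvec.span_minimal) (rule cvec.subspace_span)
    then have "w \<in> cspan {a, b}" using w(2) by blast
    moreover obtain c where c: "c \<noteq> 0" "y = cscale c w"
      using proj_pt_self[of y] w(1) proj_ptD by blast
    ultimately show ?thesis
      unfolding c(2) by (intro conjI cvec.span_scale cscale_nonzero c(1) w(3))
  qed
  have z0: "q \<notin> cspan {z}"
  proof
    assume "q \<in> cspan {z}"
    then obtain c where c: "q = cscale c z" by (auto simp: cvec.span_singleton)
    then have "c \<noteq> 0" using span[OF assms(3)] by auto
    then show False using c assms(4) by (simp add: proj_pt_cscale)
  qed
  have ind: "cvec.independent {q, z}"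
    using span[OF assms(2)] by (intro cvec.independent_insertI[OF z0]) simp
  have "x \<in> cspan {q, z}"
  proof (rule ccontr)
    assume x: "x \<notin> cspan {q, z}"
    then have "cvec.independent {x, q, z}" using ind by (rule cvec.independent_insertI)
    moreover have "{x, q, z} \<subseteq> cspan {a, b}" using span assms by blast
    ultimately have "card {x, q, z} \<le> card {a, b}"
      using cvec.independent_span_bound[of "{a, b}" "{x, q, z}"] by simp
    moreover have "card {x, q, z} = 3"
    proof -
      have "x \<noteq> q" "x \<noteq> z" "q \<noteq> z" using x z0 cvec.span_base by blast+
      then show ?thesis by simp
    qed
    moreover have "card {a, b} \<le> 2" by (simp add: card_insert_if)
    ultimately show False by simp
  qed
  then obtain t where "x - cscale t q \<in> cspan {z}" using cvec.span_breakdown_eq by blast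
  then obtain s where "x - cscale t q = cscale s z" by (auto simp: cvec.span_singleton)
  then have "x = cscale s z + cscale t q" by (simp add: algebra_simps)
  then show ?thesis by blast
qed

text \<open>
  Two successive members of the progression lie in the closure at the start. If any two successive
  members in the closure were followed by a third, all of the progression would lie in it, which
  gives infinitely many zeros to the restriction to the line of an equation that is nonzero at \<open>u + s w\<close>.
\<close>

lemma exit_from_progression:
  assumes vecs: "u \<in> vecs I" "w \<in> vecs I"
    and in01: "u \<in> affine_closure I A" "u + w \<in> affine_closure I A"
    and out: "u + cscale s w \<notin> affine_closure I A"
  shows "\<exists>n. u + cscale (of_nat n) w \<in> affine_closure I A \<and>
    u + cscale (of_nat (n + 1)) w \<in> affine_closure I A \<and>
    u + cscale (of_nat (n + 2)) w \<notin> affine_closure I A"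
proof (rule ccontr)
  let ?in = "\<lambda>n. u + cscale (of_nat n) w \<in> affine_closure I A"
  assume "\<not> ?thesis"
  then have step: "?in (n + 2)" if "?in n" "?in (n + 1)" for n using that by blast
  have "?in n \<and> ?in (n + 1)" for n
  proof (induction n)
    case 0
    have "u + cscale (of_nat 0) w = u" "u + cscale (of_nat (0 + 1)) w = u + w"
      by (simp_all add: cscale_def fun_eq_iff)
    then show ?case using in01 by metis
  next
    case (Suc n)
    then have "?in (n + 1)" "?in (n + 2)" using step by blast+
    then show ?case by (metis Suc_eq_plus1 add_2_eq_Suc')
  qed
  then have all: "?in n" for n by blast
  have "u + cscale s w \<in> vecs I" using vecs by (intro vecs_add vecs_cscale)
  with out obtain f where f: "polyfun I f" "\<forall>a\<in>A. f a = 0" "f (u + cscale s w) \<noteq> 0"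
    by (auto simp: affine_closure_def)
  obtain P where P: "\<And>t. f (u + cscale t w) = poly P t" using polyfun_on_line[OF f(1)] by blast
  have "P \<noteq> 0" using f(3) P by auto
  then have "finite {t. poly P t = 0}" by (rule poly_roots_finite)
  moreover have "range of_nat \<subseteq> {t. poly P t = 0}"
    using all f(1,2) unfolding P[symmetric] affine_closure_def by blast
  ultimately have "finite (range (of_nat :: nat \<Rightarrow> complex))" using finite_subset by blast
  then show False using range_inj_infinite[OF inj_of_nat] by blast
qed

lemma border_rank_eq_Suc:
  assumes "p \<in> secant_variety I (r + 1) X" "p \<notin> secant_variety I r X"
  shows "border_rank I X p = enat (r + 1)"
proof (rule antisym)
  show "border_rank I X p \<le> enat (r + 1)"
    unfolding border_rank_def using assms(1) by (intro INF_lower) simp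
  show "enat (r + 1) \<le> border_rank I X p"
    unfolding border_rank_def
  proof (rule INF_greatest)
    fix s assume "s \<in> {s. p \<in> secant_variety I s X}"
    then have "\<not> s \<le> r" using assms(2) secant_mono by blast
    then show "enat (r + 1) \<le> enat s" by simp
  qed
qed

theorem lemma4p1:
  fixes N r :: nat and X L :: "nat point set" and z q0 q1 :: "nat point"
  assumes "irreducible_variety {..N} X" and "nondegenerate {..N} X"
    and "r \<ge> 2"
    and "is_line {..N} L"
    and "z \<in> L \<inter> X"
    and "q0 \<in> L \<inter> secant_variety {..N} r X" and "q1 \<in> L \<inter> secant_variety {..N} r X"
    and "q0 \<noteq> q1" and "q0 \<noteq> z" and "q1 \<noteq> z"
    and "\<not> L \<subseteq> secant_variety {..N} r X"
  shows "\<exists>p\<in>proj_space {..N}.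
    border_rank {..N} X p = enat (r + 1) \<and>
    (\<forall>k\<ge>2.
       ereal_of_enat (border_rank (tensor_idx {..N} k) (segre_power k X) (tensor_power_pt k p))
         \<le> ereal (1 / 2 * ((real r + 1) ^ k + 2 * real r ^ k - (real r - 1) ^ k)) \<and>
       1 / 2 * ((real r + 1) ^ k + 2 * real r ^ k - (real r - 1) ^ k) < (real r + 1) ^ k) \<and>
    (\<forall>k\<ge>2.
       border_rank (tensor_idx {..N} k) (segre_power k X) (tensor_power_pt k p)
         < border_rank {..N} X p ^ k)"
proof -
  let ?I = "{..N}"
  let ?C = "cone_over X"
  let ?cl = "\<lambda>n. affine_closure ?I (sumset n ?C)"
  have X: "X \<subseteq> proj_space ?I"
    using assms(1) by (auto simp: irreducible_variety_def proj_variety_def zero_locus_def)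
  have Xne: "X \<noteq> {}" using assms(5) by blast
  have C: "?C \<subseteq> vecs ?I" by (rule cone_over_vecs[OF X])
  have cone: "cscale t a \<in> sumset n ?C" if "a \<in> sumset n ?C" for t a n
    using that sumset_cscale cone_over_cscale[OF X] by blast
  have cl_scale: "cscale t a \<in> ?cl n" if "a \<in> ?cl n" for t a n
    using affine_closure_cscale[OF cone sumset_vecs[OF C] that] .
  have cl_sub: "sumset n ?C \<subseteq> ?cl n" for n
    by (rule affine_closure_superset[OF sumset_vecs[OF C]])
  obtain \<zeta> where \<zeta>: "z = proj_pt \<zeta>" "\<zeta> \<in> vecs ?I"
    using assms(5) X by (auto simp: proj_space_def)
  have \<zeta>C: "\<zeta> \<in> ?C" using \<zeta> assms(5) proj_pt_self by (auto simp: cone_over_def)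
  have \<zeta>cl: "\<zeta> \<in> ?cl r"
  proof -
    have "\<zeta> \<in> sumset r ?C"
      using \<zeta>C sumset_one sumset_mono[OF zero_in_cone_over, of 1 r] assms(3) by fastforce
    then show ?thesis using cl_sub by blast
  qed
  have rep: "\<exists>v. q = proj_pt v \<and> v \<noteq> 0 \<and> v \<in> ?cl r" if q: "q \<in> secant_variety ?I r X" for q
  proof -
    obtain v where "q = proj_pt v" "v \<noteq> 0" "v \<in> vecs ?I"
      using q secant_subset_proj_space[of ?I r X] unfolding proj_space_def by blast
    then show ?thesis using secant_imp_affine_closure[OF X] q by blast
  qed
  obtain \<kappa> where \<kappa>: "q0 = proj_pt \<kappa>" "\<kappa> \<in> ?cl r" using rep assms(6) by blast
  obtain y where y: "q1 = proj_pt y" "y \<noteq> 0" "y \<in> ?cl r" using rep assms(7) by blast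
  obtain x where x: "proj_pt x \<in> L" "proj_pt x \<notin> secant_variety ?I r X" "x \<noteq> 0"
    using assms(4,11) by (auto simp: is_line_def proj_span_def)
  have xcl: "x \<notin> ?cl r" using affine_closure_imp_secant[OF X Xne, of r x] x assms(3) by auto
  have coords: "\<exists>s t. x = cscale s \<zeta> + cscale t \<kappa>" if "proj_pt x \<in> L" for x
    using line_coordinates[OF assms(4) _ _ _ that, of \<zeta> \<kappa>] assms(5,6,9) \<zeta>(1) \<kappa>(1) by auto
  \<comment> \<open>The vector over \<open>q1\<close> involves both \<open>\<zeta>\<close> and \<open>\<kappa>\<close>, so \<open>\<zeta>\<close> can be rescaled to \<open>w\<close> with \<open>\<kappa> + w\<close> over \<open>q1\<close>.\<close>
  obtain s t where st: "y = cscale s \<zeta> + cscale t \<kappa>" using coords assms(7) y(1) by blast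
  obtain s' t' where st': "x = cscale s' \<zeta> + cscale t' \<kappa>" using coords x(1) by blast
  have t: "t \<noteq> 0"
  proof
    assume "t = 0"
    then have "y = cscale s \<zeta>" "s \<noteq> 0" using st y(2) by auto
    then show False using assms(10) \<zeta>(1) y(1) by (simp add: proj_pt_cscale)
  qed
  have s: "s \<noteq> 0"
  proof
    assume "s = 0"
    then have "y = cscale t \<kappa>" using st by simp
    then show False using assms(8) \<kappa>(1) y(1) t by (simp add: proj_pt_cscale)
  qed
  have t': "t' \<noteq> 0"
  proof
    assume "t' = 0"
    then have "x = cscale s' \<zeta>" using st' by simp
    then show False using xcl cl_scale[OF \<zeta>cl] by simp
  qed
  define w where "w = cscale (s / t) \<zeta>"
  have wC: "w \<in> ?C" unfolding w_def by (rule cone_over_cscale[OF X \<zeta>C])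
  have w: "\<kappa> + w = cscale (1 / t) y"
    using t by (auto simp: w_def st cscale_def fun_eq_iff field_simps)
  \<comment> \<open>The point of \<open>L\<close> outside the secant variety, in the parametrisation \<open>\<kappa> + c w\<close> of the line.\<close>
  have "x = cscale t' (\<kappa> + cscale (s' * t / (t' * s)) w)"
    using t s t' by (auto simp: w_def st' cscale_def fun_eq_iff field_simps)
  then have out: "\<kappa> + cscale (s' * t / (t' * s)) w \<notin> ?cl r"
    using xcl cl_scale by metis
  have vecs: "\<kappa> \<in> vecs ?I" "w \<in> vecs ?I"
    using \<kappa>(2) wC C by (auto simp: affine_closure_def)
  have "\<kappa> + w \<in> ?cl r" unfolding w using y(3) by (rule cl_scale)
  from exit_from_progression[OF vecs \<kappa>(2) this out] obtain n where
    n: "\<kappa> + cscale (of_nat n) w \<in> ?cl r" "\<kappa> + cscale (of_nat (n + 1)) w \<in> ?cl r"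
      "\<kappa> + cscale (of_nat (n + 2)) w \<notin> ?cl r" by blast
  define m where "m = \<kappa> + cscale (of_nat (n + 1)) w"
  have m: "m \<in> ?cl r" using n by (simp add: m_def)
  have "m - w = \<kappa> + cscale (of_nat n) w"
    by (auto simp: m_def cscale_def fun_eq_iff algebra_simps)
  with n have mw: "m - w \<in> ?cl r" by simp
  have "m + w = \<kappa> + cscale (of_nat (n + 2)) w"
    by (auto simp: m_def cscale_def fun_eq_iff algebra_simps)
  with n have p: "m + w \<notin> ?cl r" by simp
  have "w \<in> ?cl 1" using wC sumset_one cl_sub by blast
  then have p1: "m + w \<in> ?cl (r + 1)" by (rule affine_closure_sumset_add[OF C m])
  have "0 \<in> ?cl r" using zero_in_sumset[OF zero_in_cone_over] cl_sub by blast
  with p have p0: "m + w \<noteq> 0" by metis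
  have pvecs: "m + w \<in> vecs ?I" using p1 by (simp add: affine_closure_def)
  let ?p = "proj_pt (m + w)"
  have br: "border_rank ?I X ?p = enat (r + 1)"
  proof (rule border_rank_eq_Suc)
    show "?p \<in> secant_variety ?I (r + 1) X"
      by (rule affine_closure_imp_secant[OF X Xne _ p1 p0]) simp
    show "?p \<notin> secant_variety ?I r X"
      using secant_imp_affine_closure[OF X _ pvecs] p by blast
  qed
  have bound: "border_rank (tensor_idx ?I k) (segre_power k X) (tensor_power_pt k ?p)
      \<le> enat (odd_count r k)" for k
  proof -
    have "1 \<le> odd_count r k" using assms(3) unfolding odd_count_def by (intro trans_le_add1) simp
    moreover have "segre_power k X \<noteq> {}"
      using Xne by (auto simp: segre_power_def PiE_eq_empty_iff)
    moreover have "tensor k (\<lambda>_. m + w) \<noteq> 0" by (rule tensor_nonzero) (rule p0)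
    ultimately have "tensor_power_pt k ?p \<in> secant_variety (tensor_idx ?I k) (odd_count r k) (segre_power k X)"
      unfolding tensor_power_pt_proj_pt
      by (intro affine_closure_imp_secant segre_power_in_proj_space X
          tensor_power_in_secant wC m mw)
    then show ?thesis unfolding border_rank_def by (intro INF_lower) simp
  qed
  have "ereal_of_enat (border_rank (tensor_idx ?I k) (segre_power k X) (tensor_power_pt k ?p))
      \<le> ereal (1 / 2 * ((real r + 1) ^ k + 2 * real r ^ k - (real r - 1) ^ k))" for k
  proof -
    have "ereal_of_enat (border_rank (tensor_idx ?I k) (segre_power k X) (tensor_power_pt k ?p))
        \<le> ereal_of_enat (enat (odd_count r k))"
      using bound by (simp only: ereal_of_enat_le_iff)
    then show ?thesis by (simp only: odd_count_eq ereal_of_enat_simps)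
  qed
  moreover have "border_rank (tensor_idx ?I k) (segre_power k X) (tensor_power_pt k ?p)
      < border_rank ?I X ?p ^ k" if "k \<ge> 2" for k
  proof -
    have "real (odd_count r k) < real ((r + 1) ^ k)"
      using odd_count_less[OF assms(3) that] by (simp add: odd_count_eq add.commute)
    then have "enat (odd_count r k) < enat ((r + 1) ^ k)"
      unfolding of_nat_less_iff enat_ord_simps .
    also have "\<dots> = border_rank ?I X ?p ^ k"
      unfolding br of_nat_eq_enat[symmetric] of_nat_power ..
    finally show ?thesis using bound by (rule le_less_trans[rotated])
  qed
  ultimately show ?thesis
    using br odd_count_less[OF assms(3)] proj_pt_in_space[OF pvecs p0] by blast
qed

end
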